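(* Let $n\ge 2$, $k\ge 1$, and for $i=1,\ldots,n$ let $\mathcal S^i=\{S^i_1,\ldots,S^i_n\}$ be covers of the unit ball $\mathbb B^k$ (either all of them open covers, or all of them closed covers). Let $F_j:=\bigcup_{i=1}^n S^i_j$ and $\mathcal F:=\{F_1,\ldots,F_n\}$. Suppose that $\mathcal F$ is not null-homotopic on the boundary of $\mathbb B^k$, i.e. the cover $\{F_1\cap\mathbb S^{k-1},\ldots,F_n\cap\mathbb S^{k-1}\}$ of $\mathbb S^{k-1}=\partial\mathbb B^k$ is not null-homotopic. Then there exists a permutation $\pi$ of $1,2,\ldots,n$ such that $$\bigcap_{i=1}^n S^i_{\pi(i)}\neq\emptyset .$$
   Context: A cover of a space $T$ is a finite indexed family of subsets whose union is $T$ and which are either all open or all closed in $T$. $[T,Y]$ is the set of homotopy classes of continuous maps $T\to Y$; $[f]\ne 0$ means that $f$ is not homotopic to a constant map. Homotopy class of a cover: let $\Delta^{n-1}=\{x\in\mathbb R^n: x_i\ge 0,\ x_1+\cdots+x_n=1\}$ with vertices $v_1,\ldots,v_n$ (the standard basis vectors), and fix a homeomorphism $\partial\Delta^{n-1}\cong\mathbb S^{n-2}$. Let $\mathcal U=\{U_1,\ldots,U_n\}$ be an open cover of a normal space $T$ with $\bigcap_{i=1}^n U_i=\emptyset$, and let $\Phi=\{\varphi_1,\ldots,\varphi_n\}$ be a partition of unity with $\operatorname{supp}\varphi_i\subset U_i$. Then $f_{\mathcal U,\Phi}(x)=\sum_{i}\varphi_i(x)v_i$ is a continuous map $T\to\partial\Delta^{n-1}\cong\mathbb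 S^{n-2}$ whose homotopy class does not depend on $\Phi$; this class is $\mu(\mathcal U)\in[T,\mathbb S^{n-2}]$. For a closed cover $\mathcal S=\{S_1,\ldots,S_n\}$ of $T$ with $\bigcap_i S_i=\emptyset$, put $\mu(\mathcal S):=\mu(\mathcal U)$ for any open cover $\mathcal U$ with $S_i\subset U_i$ and $\bigcap_i U_i=\emptyset$ (this does not depend on the choice of $\mathcal U$). A cover $\mathcal S=\{S_1,\ldots,S_n\}$ of $T$ is called not null-homotopic if $\bigcap_{i=1}^nS_i=\emptyset$ and $\mu(\mathcal S)\neq0$ in $[T,\mathbb S^{n-2}]$. *)

theory Defs
  imports "HOL-Analysis.Analysis" "HOL-Homology.Invariance_of_Domain"
begin

text \<open>
  The number of members of a cover is \<open>n = CARD('n)\<close>; indices, vertices of the simplex and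
  coordinates all range over the finite type \<open>'n\<close>, and \<open>nsphere p\<close> is the library's
  topological \<open>p\<close>-sphere, so \<open>nsphere (CARD('n) - 2)\<close> is the sphere of dimension \<open>n - 2\<close>.
\<close>

definition is_open_cover :: "'a topology \<Rightarrow> ('n::finite \<Rightarrow> 'a set) \<Rightarrow> bool" where
  "is_open_cover T U \<longleftrightarrow> (\<forall>i. openin T (U i)) \<and> (\<Union>i. U i) = topspace T"

definition is_closed_cover :: "'a topology \<Rightarrow> ('n::finite \<Rightarrow> 'a set) \<Rightarrow> bool" where
  "is_closed_cover T S \<longleftrightarrow> (\<forall>i. closedin T (S i)) \<and> (\<Union>i. S i) = topspace T"

definition std_simplex :: "(real^'n) set" where
  "std_simplex = {x. (\<forall>i. 0 \<le> x $ i) \<and> (\<Sum>i\<in>UNIV. x $ i) = 1}"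

definition simplex_bdry :: "(real^'n) set" where
  "simplex_bdry = rel_frontier std_simplex"

definition partition_of_unity ::
    "'a topology \<Rightarrow> ('n::finite \<Rightarrow> 'a set) \<Rightarrow> ('n \<Rightarrow> 'a \<Rightarrow> real) \<Rightarrow> bool" where
  "partition_of_unity T U \<phi> \<longleftrightarrow>
     (\<forall>i. continuous_map T euclideanreal (\<phi> i)) \<and>
     (\<forall>i. \<forall>x\<in>topspace T. 0 \<le> \<phi> i x) \<and>
     (\<forall>x\<in>topspace T. (\<Sum>i\<in>UNIV. \<phi> i x) = 1) \<and>
     (\<forall>i. T closure_of {x \<in> topspace T. \<phi> i x \<noteq> 0} \<subseteq> U i)"

definition cover_map :: "('n::finite \<Rightarrow> 'a \<Rightarrow> real) \<Rightarrow> 'a \<Rightarrow> real^'n" where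
  "cover_map \<phi> x = (\<Sum>i\<in>UNIV. \<phi> i x *\<^sub>R axis i 1)"

definition homotopy_class :: "'a topology \<Rightarrow> 'b topology \<Rightarrow> ('a \<Rightarrow> 'b) \<Rightarrow> ('a \<Rightarrow> 'b) set" where
  "homotopy_class T Y f = {g. homotopic_with (\<lambda>_. True) T Y f g}"

text \<open>
  Below, \<open>h\<close> is the fixed homeomorphism from the boundary of the
  simplex to the sphere. The Hilbert choices only select the auxiliary data (a partition of
  unity, an open enlargement) on which the homotopy class does not depend.
\<close>

definition mu_open ::
    "(real^'n \<Rightarrow> nat \<Rightarrow> real) \<Rightarrow> 'a topology \<Rightarrow> ('n::finite \<Rightarrow> 'a set) \<Rightarrow> ('a \<Rightarrow> nat \<Rightarrow> real) set" where
  "mu_open h T U =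
     homotopy_class T (nsphere (CARD('n) - 2))
       (h \<circ> cover_map (SOME \<phi>. partition_of_unity T U \<phi>))"

definition mu_closed ::
    "(real^'n \<Rightarrow> nat \<Rightarrow> real) \<Rightarrow> 'a topology \<Rightarrow> ('n::finite \<Rightarrow> 'a set) \<Rightarrow> ('a \<Rightarrow> nat \<Rightarrow> real) set" where
  "mu_closed h T S =
     mu_open h T (SOME U. is_open_cover T U \<and> (\<forall>i. S i \<subseteq> U i) \<and> (\<Inter>i. U i) = {})"

text \<open>
  If all members of a cover are clopen, both clauses apply and agree, because a cover
  with empty intersection is then an open enlargement of itself.
\<close>

definition mu ::
    "(real^'n \<Rightarrow> nat \<Rightarrow> real) \<Rightarrow> 'a topology \<Rightarrow> ('n::finite \<Rightarrow> 'a set) \<Rightarrow> ('a \<Rightarrow> nat \<Rightarrow> real) set" where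
  "mu h T S = (if is_open_cover T S then mu_open h T S else mu_closed h T S)"

definition null_class :: "'a topology \<Rightarrow> 'b topology \<Rightarrow> ('a \<Rightarrow> 'b) set \<Rightarrow> bool" where
  "null_class T Y c \<longleftrightarrow> (\<exists>a\<in>topspace Y. c = homotopy_class T Y (\<lambda>_. a))"

definition not_null_homotopic ::
    "(real^'n \<Rightarrow> nat \<Rightarrow> real) \<Rightarrow> 'a topology \<Rightarrow> ('n::finite \<Rightarrow> 'a set) \<Rightarrow> bool" where
  "not_null_homotopic h T S \<longleftrightarrow>
     (is_open_cover T S \<or> is_closed_cover T S) \<and> (\<Inter>i. S i) = {} \<and>
     \<not> null_class T (nsphere (CARD('n) - 2)) (mu h T S)"

lemma std_simplex_eq_convex_hull:
  "(std_simplex :: (real^'n) set) = convex hull (range (\<lambda>i. axis i 1))"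
proof
  show "(std_simplex :: (real^'n) set) \<subseteq> convex hull (range (\<lambda>i. axis i 1))"
  proof
    fix x :: "real^'n" assume x: "x \<in> std_simplex"
    have "(\<Sum>i\<in>UNIV. x $ i *\<^sub>R axis i (1::real)) \<in> convex hull (range (\<lambda>i::'n. axis i (1::real)))"
      by (rule convex_sum) (use x in \<open>auto simp: std_simplex_def hull_inc\<close>)
    moreover have "(\<Sum>i\<in>UNIV. x $ i *\<^sub>R axis i (1::real)) = x"
      by (simp add: vec_eq_iff axis_def if_distrib cong: if_cong)
    ultimately show "x \<in> convex hull (range (\<lambda>i. axis i 1))" by simp
  qed
  have "convex (std_simplex :: (real^'n) set)"
    by (auto simp: convex_def std_simplex_def sum.distrib sum_distrib_left[symmetric])
  then show "convex hull (range (\<lambda>i. axis i 1)) \<subseteq> (std_simplex :: (real^'n) set)"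
    by (intro hull_minimal) (auto simp: std_simplex_def axis_def)
qed

text \<open>A homeomorphism as required of \<open>h\<close> exists.\<close>

lemma simplex_bdry_homeomorphic_nsphere:
  assumes "CARD('n::finite) \<ge> 2"
  shows "\<exists>h. homeomorphic_map (top_of_set (simplex_bdry :: (real^'n) set)) (nsphere (CARD('n) - 2)) h"
proof -
  let ?V = "range (\<lambda>i::'n. axis i (1::real))"
  have V: "?V = (Basis :: (real^'n) set)" by (auto simp: Basis_vec_def)
  have ind: "\<not> affine_dependent (Basis :: (real^'n) set)"
    using affine_dependent_imp_dependent independent_Basis by blast
  have "aff_dim (Basis :: (real^'n) set) = int (card (Basis :: (real^'n) set)) - 1"
    using aff_dim_affine_independent[OF ind] by simp
  then have adim: "aff_dim (std_simplex :: (real^'n) set) = int (CARD('n)) - 1"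
    unfolding std_simplex_eq_convex_hull V aff_dim_convex_hull by simp
  have comp: "convex (std_simplex :: (real^'n) set)" "bounded (std_simplex :: (real^'n) set)"
    unfolding std_simplex_eq_convex_hull V by (simp_all add: bounded_convex_hull finite_imp_bounded)
  obtain B :: "(real^'n) set" where B: "B \<subseteq> Basis" "card B = CARD('n) - 1"
    using obtain_subset_with_card_n[of "CARD('n) - 1" "Basis :: (real^'n) set"] by auto
  have indB: "independent B" using B independent_Basis independent_mono by blast
  have orth: "pairwise orthogonal B"
    using B inner_not_same_Basis unfolding pairwise_def orthogonal_def by blast
  obtain f g where fg:
    "homeomorphic_maps (nsphere (CARD('n) - 1 - 1)) (top_of_set (sphere 0 1 \<inter> span B)) f g"
    by (rule homeomorphic_maps_nsphere_euclidean_sphere[OF indB orth B(2)])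
       (use assms B in auto)
  have "(0::real^'n) \<in> interior (cball 0 1) \<inter> span B" by (simp add: span_zero)
  then have ne: "interior (cball (0::real^'n) 1) \<inter> span B \<noteq> {}" by blast
  have aff: "affine (span B)" by (simp add: subspace_imp_affine)
  have "aff_dim (cball 0 1 \<inter> span B) = aff_dim (span B)"
    using aff_dim_convex_Int_nonempty_interior[of "span B" "cball 0 1"] ne
    by (simp add: Int_commute subspace_imp_convex)
  also have "\<dots> = int (dim (span B))" by (simp add: aff_dim_subspace)
  also have "dim (span B) = CARD('n) - 1" using indB B dim_span_eq_card_independent by metis
  finally have "aff_dim (cball 0 1 \<inter> span B) = int (CARD('n) - 1)" .
  then have "rel_frontier (std_simplex :: (real^'n) set) homeomorphic rel_frontier (cball 0 1 \<inter> span B)"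
    using adim comp assms
    by (intro homeomorphic_rel_frontiers_convex_bounded_sets)
       (auto simp: convex_Int subspace_imp_convex bounded_Int)
  also have "rel_frontier (cball 0 1 \<inter> span B) = sphere 0 1 \<inter> span B"
    using convex_affine_rel_frontier_Int[OF convex_cball aff ne] by simp
  finally have "top_of_set (simplex_bdry :: (real^'n) set) homeomorphic_space top_of_set (sphere 0 1 \<inter> span B)"
    unfolding simplex_bdry_def homeomorphic_space_iff_homeomorphic .
  also have "top_of_set (sphere 0 1 \<inter> span B) homeomorphic_space nsphere (CARD('n) - 1 - 1)"
    unfolding homeomorphic_space_def using fg homeomorphic_maps_sym by blast
  also have "CARD('n) - 1 - 1 = CARD('n) - 2" by simp
  finally show ?thesis unfolding homeomorphic_space .
qed

end

theory Submission
  imports Defs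
begin

text \<open>
  Call a point of the ball rainbow if it lies in \<open>S i (\<pi> i)\<close> for all \<open>i\<close> and some permutation \<open>\<pi>\<close>.
  Take the covers open, choose for each of them a subordinate family \<open>\<phi> i\<close> of functions, and let
  \<open>\<psi>\<close> be the average of the \<open>\<phi> i\<close>. It is subordinate to the cover by the unions \<open>F j\<close>, so its
  cover map sends the ball to the simplex and the boundary sphere to the boundary of the simplex,
  where it represents the class of \<open>F\<close>. If this map takes the barycentre as value at \<open>x\<close>, then the
  matrix \<open>\<phi> i j x\<close> is doubly stochastic, hence positive along some permutation
  (\<open>doubly_stochastic_positive_permutation\<close>, the first step of Birkhoff's theorem, resting on
  Hall's marriage theorem), and \<open>x\<close> is a rainbow point. Otherwise, the map can be pushed away
  from the barycentre into the boundary of the simplex. The restriction to the sphere then extends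
  over the contractible ball as a map to that boundary, so it is homotopic to a constant
  (\<open>null_homotopic_if_no_rainbow\<close>).

  Closed covers are replaced by their \<open>e\<close>-neighbourhoods. By compactness, no rainbow
  point is created when \<open>e\<close> is small, and the intersection of the \<open>F j\<close> with the sphere stays
  empty (\<open>eventually_neighbourhoods_disjoint\<close>).

  It remains to compare this construction with the class \<open>mu\<close>, which is defined through
  arbitrarily chosen data: an open enlargement of the cover and a partition of unity. Any two
  choices give homotopic maps (\<open>homotopic_if_common_core\<close>). They are compared through a family
  subordinate to the intersections of the two enlargements; two families subordinate to the same
  cover are joined by a straight line, which never leaves the face of the simplex opposite to a
  vertex whose cover member misses the point.
\<close>

section \<open>Permutations in the support of a doubly stochastic matrix\<close>

text \<open>
  Hall's marriage theorem, by Rado's argument: shrink the sets as long as Hall's condition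
  survives. Suppose that \<open>A i\<close> has two distinct elements \<open>x\<close> and \<open>y\<close>, and that neither can be
  removed. The failures of Hall's condition are witnessed by \<open>insert i J\<close> and \<open>insert i K\<close>;
  applying the condition to \<open>insert i (J \<union> K)\<close> and to \<open>J \<inter> K\<close> contradicts modularity of the
  cardinality. When no set can be shrunk, all are singletons and pairwise distinct.
\<close>

lemma hall_matching:
  fixes A :: "'i::finite \<Rightarrow> 'a set"
  assumes "\<And>i. finite (A i)"
    and "\<And>J. card J \<le> card (\<Union>i\<in>J. A i)"
  shows "\<exists>f. inj f \<and> (\<forall>i. f i \<in> A i)"
  using assms
proof (induction "\<Sum>i\<in>UNIV. card (A i)" arbitrary: A rule: less_induct)
  case less
  note fin = less.prems(1) and hall = less.prems(2)
  have ge1: "A i \<noteq> {}" for i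
    using hall[of "{i}"] by auto
  show ?case
  proof (cases "\<exists>i x y. x \<in> A i \<and> y \<in> A i \<and> x \<noteq> y")
    case True
    then obtain i x y where xy: "x \<in> A i" "y \<in> A i" "x \<noteq> y" by blast
    have shrink: "\<exists>J. i \<notin> J \<and> card ((\<Union>j\<in>J. A j) \<union> (A i - {z})) \<le> card J"
      if z: "z \<in> A i" and no: "\<nexists>f. inj f \<and> (\<forall>i. f i \<in> A i)" for z
    proof -
      define B where "B = A(i := A i - {z})"
      have "(\<Sum>j\<in>UNIV. card (B j)) < (\<Sum>j\<in>UNIV. card (A j))"
      proof (rule sum_strict_mono_ex1)
        show "\<forall>j\<in>UNIV. card (B j) \<le> card (A j)"
          by (auto simp: B_def fin intro!: card_mono)
        have "card (B i) < card (A i)"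
          unfolding B_def fun_upd_same by (rule card_Diff1_less[OF fin z])
        then show "\<exists>j\<in>UNIV. card (B j) < card (A j)" by blast
      qed simp
      moreover have "finite (B j)" for j by (simp add: B_def fin)
      moreover have "\<nexists>f. inj f \<and> (\<forall>j. f j \<in> B j)"
        using no by (auto simp: B_def split: if_splits)
      ultimately obtain J where J: "\<not> card J \<le> card (\<Union>j\<in>J. B j)"
        using less.hyps[of B] by blast
      have iJ: "i \<in> J"
      proof (rule ccontr)
        assume "i \<notin> J"
        then have "(\<Union>j\<in>J. B j) = (\<Union>j\<in>J. A j)" by (auto simp: B_def)
        with J hall[of J] show False by simp
      qed
      then have "(\<Union>j\<in>J. B j) = (\<Union>j\<in>J - {i}. A j) \<union> (A i - {z})"
        by (auto simp: B_def split: if_splits)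
      with J iJ show ?thesis
        by (intro exI[of _ "J - {i}"]) auto
    qed
    show ?thesis
    proof (rule ccontr)
      assume no: "\<nexists>f. inj f \<and> (\<forall>i. f i \<in> A i)"
      obtain J where J: "i \<notin> J" "card ((\<Union>j\<in>J. A j) \<union> (A i - {x})) \<le> card J"
        using shrink[OF xy(1) no] by blast
      obtain K where K: "i \<notin> K" "card ((\<Union>j\<in>K. A j) \<union> (A i - {y})) \<le> card K"
        using shrink[OF xy(2) no] by blast
      \<comment> \<open>\<open>?P \<union> ?Q\<close> contains all of \<open>A i\<close>, because \<open>x\<close> and \<open>y\<close> are distinct.\<close>
      let ?P = "(\<Union>j\<in>J. A j) \<union> (A i - {x})" and ?Q = "(\<Union>j\<in>K. A j) \<union> (A i - {y})"
      have finPQ: "finite ?P" "finite ?Q" using fin by auto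
      have "card (J \<union> K) + 1 = card (insert i (J \<union> K))" using J K by simp
      also have "\<dots> \<le> card (\<Union>j\<in>insert i (J \<union> K). A j)" by (rule hall)
      also have "\<dots> \<le> card (?P \<union> ?Q)"
        by (rule card_mono) (use finPQ xy in auto)
      finally have 1: "card (J \<union> K) + 1 \<le> card (?P \<union> ?Q)" .
      have "card (J \<inter> K) \<le> card (\<Union>j\<in>J \<inter> K. A j)" by (rule hall)
      also have "\<dots> \<le> card (?P \<inter> ?Q)"
        by (rule card_mono) (use finPQ in auto)
      finally have 2: "card (J \<inter> K) \<le> card (?P \<inter> ?Q)" .
      have "card ?P + card ?Q = card (?P \<union> ?Q) + card (?P \<inter> ?Q)"
        by (rule card_Un_Int) (use finPQ in auto)
      moreover have "card J + card K = card (J \<union> K) + card (J \<inter> K)"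
        by (rule card_Un_Int) auto
      ultimately show False using 1 2 J K by linarith
    qed
  next
    case False
    obtain f where f: "\<And>i. f i \<in> A i" using ge1 choice[of "\<lambda>i a. a \<in> A i"] by blast
    have A: "A i = {f i}" for i using False f by auto
    have "inj f"
    proof (rule injI, rule ccontr)
      fix i j assume "f i = f j" "i \<noteq> j"
      then show False using hall[of "{i, j}"] by (simp add: A)
    qed
    with f show ?thesis by blast
  qed
qed

text \<open>
  Hall's condition holds for the supports of the rows: a set \<open>J\<close> of rows carries total mass
  \<open>card J\<close>, all of it in the columns that meet the supports of these rows, and each column has
  room for mass 1 only.
\<close>

lemma doubly_stochastic_positive_permutation:
  fixes M :: "'n::finite \<Rightarrow> 'n \<Rightarrow> real"
  assumes nonneg: "\<And>i j. 0 \<le> M i j"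
    and rows: "\<And>i. (\<Sum>j\<in>UNIV. M i j) = 1"
    and cols: "\<And>j. (\<Sum>i\<in>UNIV. M i j) = 1"
  shows "\<exists>\<pi>. \<pi> permutes UNIV \<and> (\<forall>i. 0 < M i (\<pi> i))"
proof -
  define A where "A i = {j. 0 < M i j}" for i
  have "card J \<le> card (\<Union>i\<in>J. A i)" for J
  proof -
    let ?N = "\<Union>i\<in>J. A i"
    have "real (card J) = (\<Sum>i\<in>J. \<Sum>j\<in>UNIV. M i j)" by (simp add: rows)
    also have "\<dots> = (\<Sum>i\<in>J. \<Sum>j\<in>?N. M i j)"
    proof (rule sum.cong[OF refl])
      fix i assume i: "i \<in> J"
      have "M i j = 0" if "j \<notin> ?N" for j
        using that i nonneg[of i j] by (auto simp: A_def not_less)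
      then show "(\<Sum>j\<in>UNIV. M i j) = (\<Sum>j\<in>?N. M i j)"
        by (intro sum.mono_neutral_right) auto
    qed
    also have "\<dots> = (\<Sum>j\<in>?N. \<Sum>i\<in>J. M i j)" by (rule sum.swap)
    also have "\<dots> \<le> (\<Sum>j\<in>?N. \<Sum>i\<in>UNIV. M i j)"
      by (intro sum_mono sum_mono2) (auto simp: nonneg)
    also have "\<dots> = real (card ?N)" by (simp add: cols)
    finally show ?thesis by simp
  qed
  then obtain \<pi> where "inj \<pi>" "\<forall>i. \<pi> i \<in> A i"
    using hall_matching[of A] by auto
  then show ?thesis
    by (intro exI[of _ \<pi>]) (auto simp: A_def permutes_bij intro!: bij_imp_permutes finite_UNIV_inj_surj bijI)
qed

section \<open>Partitions of unity for open covers of metric spaces\<close>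

text \<open>
  Weaker than \<^const>\<open>partition_of_unity\<close>: only the set where a function does not vanish, rather than
  its closure, has to lie in the member of the cover. This condition passes to averages and to
  subsets of the space at once, and it suffices for all homotopies below.
\<close>

definition subordinate :: "'a::metric_space set \<Rightarrow> ('n::finite \<Rightarrow> 'a set) \<Rightarrow> ('n \<Rightarrow> 'a \<Rightarrow> real) \<Rightarrow> bool" where
  "subordinate K U \<phi> \<longleftrightarrow>
     (\<forall>i. continuous_on K (\<phi> i)) \<and>
     (\<forall>x\<in>K. (\<forall>i. 0 \<le> \<phi> i x) \<and> (\<Sum>i\<in>UNIV. \<phi> i x) = 1) \<and>
     (\<forall>x\<in>K. \<forall>i. \<phi> i x \<noteq> 0 \<longrightarrow> x \<in> U i)"

lemma partition_of_unity_imp_subordinate: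
  assumes "partition_of_unity (top_of_set K) U \<phi>"
  shows "subordinate K U \<phi>"
proof -
  have "x \<in> U i" if "x \<in> K" "\<phi> i x \<noteq> 0" for x i
  proof -
    have "x \<in> {x \<in> topspace (top_of_set K). \<phi> i x \<noteq> 0}" using that by simp
    also have "\<dots> \<subseteq> top_of_set K closure_of {x \<in> topspace (top_of_set K). \<phi> i x \<noteq> 0}"
      by (rule closure_of_subset) auto
    also have "\<dots> \<subseteq> U i" using assms by (auto simp: partition_of_unity_def)
    finally show ?thesis .
  qed
  with assms show ?thesis
    by (auto simp: partition_of_unity_def subordinate_def)
qed

lemma subordinate_exists:
  fixes U :: "'n::finite \<Rightarrow> 'a::metric_space set"
  assumes U: "is_open_cover (top_of_set K) U"
  shows "\<exists>\<phi>. subordinate K U \<phi>"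
proof -
  \<comment> \<open>The distance to the empty set is 0 by convention, so a member containing \<open>K\<close> is treated
    separately.\<close>
  define g where "g i x = (if K \<subseteq> U i then 1 else infdist x (K - U i))" for i x
  have cont: "continuous_on K (g i)" for i
    unfolding g_def by (cases "K \<subseteq> U i") (auto intro!: continuous_intros)
  have nonneg: "0 \<le> g i x" for i x by (simp add: g_def infdist_nonneg)
  have pos: "0 < g i x" if x: "x \<in> K" "x \<in> U i" for i x
  proof (cases "K \<subseteq> U i")
    case False
    have "openin (top_of_set K) (U i)" using U by (simp add: is_open_cover_def)
    then obtain W where W: "open W" "U i = K \<inter> W" by (auto simp: openin_open)
    then have "K - U i \<subseteq> - W" "closed (- W)" by auto
    then have "x \<notin> closure (K - U i)" using x W closure_minimal by blast
    then have "infdist x (K - U i) \<noteq> 0"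
      using False in_closure_iff_infdist_zero[of "K - U i" x] by auto
    then show ?thesis using False infdist_nonneg[of x "K - U i"] by (simp add: g_def less_le)
  qed (simp add: g_def)
  have zero: "x \<in> U i" if "x \<in> K" "g i x \<noteq> 0" for i x
    using that by (auto simp: g_def split: if_splits intro: ccontr)
  have sum_pos: "0 < (\<Sum>i\<in>UNIV. g i x)" if x: "x \<in> K" for x
  proof -
    have "(\<Union>i. U i) = K" using U by (simp add: is_open_cover_def)
    then obtain i where "x \<in> U i" using x by blast
    then show ?thesis
      by (intro sum_pos2[of _ i]) (use pos[OF x] nonneg in auto)
  qed
  have "subordinate K U (\<lambda>i x. g i x / (\<Sum>j\<in>UNIV. g j x))"
    unfolding subordinate_def
  proof (intro conjI allI ballI impI)
    fix i show "continuous_on K (\<lambda>x. g i x / (\<Sum>j\<in>UNIV. g j x))"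
      using sum_pos by (intro continuous_intros cont) force
  next
    fix x i assume x: "x \<in> K"
    show "0 \<le> g i x / (\<Sum>j\<in>UNIV. g j x)" using nonneg by (simp add: sum_nonneg)
    show "(\<Sum>i\<in>UNIV. g i x / (\<Sum>j\<in>UNIV. g j x)) = 1"
      using sum_pos[OF x] by (simp flip: sum_divide_distrib)
    show "x \<in> U i" if "g i x / (\<Sum>j\<in>UNIV. g j x) \<noteq> 0"
      using zero[OF x] that by auto
  qed
  then show ?thesis by blast
qed

text \<open>
  Cut a subordinate family off at a positive level \<open>c\<close>: the closure of the set where the result is
  nonzero lies in the closed set where the original function is at least \<open>c\<close>, hence in \<open>U i\<close>.
\<close>

lemma partition_of_unity_exists:
  fixes U :: "'n::finite \<Rightarrow> 'a::metric_space set"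
  assumes U: "is_open_cover (top_of_set K) U"
  shows "\<exists>\<phi>. partition_of_unity (top_of_set K) U \<phi>"
proof -
  obtain \<psi> where \<psi>: "subordinate K U \<psi>" using subordinate_exists[OF U] by blast
  \<comment> \<open>The functions sum to 1 and cutting lowers the sum by at most \<open>1 / 2\<close>, so it stays positive.\<close>
  define c where "c = 1 / (2 * real CARD('n))"
  have c: "c > 0" by (simp add: c_def)
  define g where "g i x = max 0 (\<psi> i x - c)" for i x
  have cont: "continuous_on K (g i)" for i
    unfolding g_def using \<psi> by (intro continuous_intros) (simp add: subordinate_def)
  have nonneg: "0 \<le> g i x" for i x by (simp add: g_def)
  have sum_pos: "0 < (\<Sum>i\<in>UNIV. g i x)" if "x \<in> K" for x
  proof -
    have "(\<Sum>i\<in>(UNIV::'n set). c) = 1 / 2" by (simp add: c_def)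
    moreover have "(\<Sum>i\<in>UNIV. \<psi> i x) = 1" using \<psi> that by (simp add: subordinate_def)
    moreover have "(\<Sum>i\<in>UNIV. \<psi> i x) - (\<Sum>i\<in>(UNIV::'n set). c) \<le> (\<Sum>i\<in>UNIV. g i x)"
      unfolding sum_subtractf[symmetric] by (intro sum_mono) (simp add: g_def)
    ultimately show ?thesis by linarith
  qed
  have "partition_of_unity (top_of_set K) U (\<lambda>i x. g i x / (\<Sum>j\<in>UNIV. g j x))"
    unfolding partition_of_unity_def
  proof (intro conjI allI ballI)
    fix i
    show "continuous_map (top_of_set K) euclideanreal (\<lambda>x. g i x / (\<Sum>j\<in>UNIV. g j x))"
      using sum_pos by (auto intro!: continuous_intros cont) force
    let ?Z = "{x \<in> K. c \<le> \<psi> i x}"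
    have "closedin (top_of_set K) (K \<inter> \<psi> i -` {c..})"
      using \<psi> by (intro continuous_closedin_preimage) (auto simp: subordinate_def)
    then have "closedin (top_of_set K) ?Z" by (simp add: vimage_def Collect_conj_eq)
    moreover have "{x \<in> topspace (top_of_set K). g i x / (\<Sum>j\<in>UNIV. g j x) \<noteq> 0} \<subseteq> ?Z"
      by (auto simp: g_def max_def split: if_splits)
    ultimately have "top_of_set K closure_of {x \<in> topspace (top_of_set K). g i x / (\<Sum>j\<in>UNIV. g j x) \<noteq> 0} \<subseteq> ?Z"
      by (rule closure_of_minimal[rotated])
    also have "?Z \<subseteq> U i" using \<psi> c by (force simp: subordinate_def)
    finally show "top_of_set K closure_of {x \<in> topspace (top_of_set K). g i x / (\<Sum>j\<in>UNIV. g j x) \<noteq> 0} \<subseteq> U i" .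
  next
    fix i x
    show "0 \<le> g i x / (\<Sum>j\<in>UNIV. g j x)" using nonneg by (simp add: sum_nonneg)
  next
    fix x assume "x \<in> topspace (top_of_set K)"
    then show "(\<Sum>i\<in>UNIV. g i x / (\<Sum>j\<in>UNIV. g j x)) = 1"
      using sum_pos[of x] by (simp flip: sum_divide_distrib)
  qed
  then show ?thesis by blast
qed

section \<open>Homotopies between cover maps\<close>

lemma cover_map_nth [simp]: "cover_map \<phi> x $ i = \<phi> i x"
  by (simp add: cover_map_def axis_def if_distrib cong: if_cong)

lemma continuous_on_cover_map:
  assumes "\<And>i. continuous_on K (\<phi> i)"
  shows "continuous_on K (cover_map \<phi>)"
  unfolding cover_map_def by (intro continuous_intros assms)

lemma rel_interior_std_simplex:
  "rel_interior (std_simplex :: (real^'n) set) = {x \<in> std_simplex. \<forall>i. 0 < x $ i}"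
proof -
  let ?V = "range (\<lambda>i::'n. axis i (1::real))"
  have V: "?V = (Basis :: (real^'n) set)" by (auto simp: Basis_vec_def)
  have ind: "\<not> affine_dependent ?V"
    unfolding V using affine_dependent_imp_dependent independent_Basis by blast
  have inj: "inj (\<lambda>i::'n. axis i (1::real))" by (auto simp: inj_on_def axis_eq_axis)
  show ?thesis
    unfolding std_simplex_eq_convex_hull rel_interior_convex_hull_explicit[OF ind]
  proof (rule Set.set_eqI, rule iffI)
    fix y :: "real^'n"
    assume "y \<in> {y. \<exists>u. (\<forall>x\<in>?V. 0 < u x) \<and> sum u ?V = 1 \<and> (\<Sum>x\<in>?V. u x *\<^sub>R x) = y}"
    then obtain u where u: "\<forall>x\<in>?V. 0 < u x" "sum u ?V = 1" "(\<Sum>x\<in>?V. u x *\<^sub>R x) = y" by blast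
    then have "y = (\<Sum>i\<in>UNIV. u (axis i 1) *\<^sub>R axis i 1)"
      by (simp add: sum.reindex[OF inj])
    then have y: "y $ i = u (axis i 1)" for i
      by (simp add: axis_def if_distrib cong: if_cong)
    have "y \<in> std_simplex"
      using u by (auto simp: std_simplex_def y sum.reindex[OF inj] less_imp_le)
    then show "y \<in> {x \<in> convex hull ?V. \<forall>i. 0 < x $ i}"
      using u by (simp add: y flip: std_simplex_eq_convex_hull)
  next
    fix y :: "real^'n"
    assume "y \<in> {x \<in> convex hull ?V. \<forall>i. 0 < x $ i}"
    then have y: "y \<in> std_simplex" "\<forall>i. 0 < y $ i"
      by (simp_all flip: std_simplex_eq_convex_hull)
    \<comment> \<open>The coordinates of \<open>y\<close>, reindexed by the vertices, are the required weights.\<close>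
    define u where "u x = y $ (THE i. x = axis i 1)" for x :: "real^'n"
    have u: "u (axis i 1) = y $ i" for i
      unfolding u_def by (simp add: axis_eq_axis)
    have "(\<Sum>x\<in>?V. u x *\<^sub>R x) = (\<Sum>i\<in>UNIV. y $ i *\<^sub>R axis i 1)"
      by (simp add: sum.reindex[OF inj] u)
    also have "\<dots> = y"
      by (simp add: vec_eq_iff axis_def if_distrib cong: if_cong)
    finally have "(\<Sum>x\<in>?V. u x *\<^sub>R x) = y" .
    moreover have "sum u ?V = 1"
      using y by (simp add: sum.reindex[OF inj] u std_simplex_def)
    moreover have "\<forall>x\<in>?V. 0 < u x"
      using y u by simp
    ultimately show "y \<in> {y. \<exists>u. (\<forall>x\<in>?V. 0 < u x) \<and> sum u ?V = 1 \<and> (\<Sum>x\<in>?V. u x *\<^sub>R x) = y}"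
      by blast
  qed
qed

lemma compact_convex_std_simplex:
  "compact (std_simplex :: (real^'n) set)" "convex (std_simplex :: (real^'n) set)"
  by (simp_all add: std_simplex_eq_convex_hull finite_imp_compact compact_convex_hull)

lemma simplex_bdry_eq:
  "(simplex_bdry :: (real^'n) set) = {x \<in> std_simplex. \<exists>i. x $ i = 0}"
proof -
  have "closure std_simplex = (std_simplex :: (real^'n) set)"
    by (intro closure_closed compact_imp_closed compact_convex_std_simplex(1))
  then show ?thesis
    unfolding simplex_bdry_def rel_frontier_def rel_interior_std_simplex
    by (auto simp: std_simplex_def less_le)
qed

lemma cover_map_in_std_simplex:
  assumes "subordinate K U \<phi>" "x \<in> K"
  shows "cover_map \<phi> x \<in> std_simplex"
  using assms by (simp add: subordinate_def std_simplex_def)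

text \<open>
  A point \<open>x\<close> misses some \<open>U i\<close>; both maps send it to the convex face of the simplex on which the
  \<open>i\<close>-th coordinate vanishes, so the straight-line homotopy stays in the boundary.
\<close>

lemma homotopic_if_subordinate:
  fixes U :: "'n::finite \<Rightarrow> 'a::metric_space set"
  assumes \<phi>: "subordinate K U \<phi>" and \<psi>: "subordinate K U \<psi>"
    and U: "K \<inter> (\<Inter>i. U i) = {}"
  shows "homotopic_with_canon (\<lambda>_. True) K simplex_bdry (cover_map \<phi>) (cover_map \<psi>)"
proof (rule homotopic_with_linear)
  show "continuous_on K (cover_map \<phi>)" "continuous_on K (cover_map \<psi>)"
    using \<phi> \<psi> by (auto simp: subordinate_def intro: continuous_on_cover_map)
  fix x assume x: "x \<in> K"
  then obtain i where i: "x \<notin> U i" using U by blast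
  let ?face = "{y \<in> std_simplex. y $ i = (0::real)}"
  have "convex ?face"
    using compact_convex_std_simplex(2) by (auto simp: convex_alt)
  moreover have "cover_map \<phi> x \<in> ?face" "cover_map \<psi> x \<in> ?face"
    using cover_map_in_std_simplex[OF \<phi> x] cover_map_in_std_simplex[OF \<psi> x] \<phi> \<psi> x i
    by (auto simp: subordinate_def)
  ultimately have "closed_segment (cover_map \<phi> x) (cover_map \<psi> x) \<subseteq> ?face"
    by (simp add: closed_segment_subset)
  then show "closed_segment (cover_map \<phi> x) (cover_map \<psi> x) \<subseteq> simplex_bdry"
    by (auto simp: simplex_bdry_eq)
qed

text \<open>
  The intersections \<open>U i \<inter> V i\<close> still cover \<open>K\<close>, because they contain the \<open>C i\<close>, and a family
  subordinate to them is subordinate to both \<open>U\<close> and \<open>V\<close>. Applied to two open enlargements of a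
  cover \<open>C\<close>, this is the independence of the homotopy class from all choices.
\<close>

lemma homotopic_if_common_core:
  fixes U V C :: "'n::finite \<Rightarrow> 'a::metric_space set"
  assumes \<phi>: "subordinate K U \<phi>" and \<psi>: "subordinate K V \<psi>"
    and opn: "\<And>i. openin (top_of_set K) (U i)" "\<And>i. openin (top_of_set K) (V i)"
    and C: "K \<subseteq> (\<Union>i. C i)" "\<And>i. C i \<subseteq> U i" "\<And>i. C i \<subseteq> V i"
    and empty: "K \<inter> (\<Inter>i. U i) = {}" "K \<inter> (\<Inter>i. V i) = {}"
  shows "homotopic_with_canon (\<lambda>_. True) K simplex_bdry (cover_map \<phi>) (cover_map \<psi>)"
proof -
  have "is_open_cover (top_of_set K) (\<lambda>i. U i \<inter> V i)"
    unfolding is_open_cover_def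
  proof (intro conjI allI openin_Int opn)
    have "(\<Union>i. U i \<inter> V i) \<subseteq> K" using openin_imp_subset[OF opn(1)] by blast
    moreover have "K \<subseteq> (\<Union>i. U i \<inter> V i)"
    proof
      fix x assume "x \<in> K"
      then obtain i where "x \<in> C i" using C(1) by blast
      then show "x \<in> (\<Union>i. U i \<inter> V i)" using C(2)[of i] C(3)[of i] by blast
    qed
    ultimately show "(\<Union>i. U i \<inter> V i) = topspace (top_of_set K)" by simp
  qed
  then obtain \<theta> where \<theta>: "subordinate K (\<lambda>i. U i \<inter> V i) \<theta>"
    using subordinate_exists by blast
  then have "subordinate K U \<theta>" "subordinate K V \<theta>" by (auto simp: subordinate_def)
  then show ?thesis
    using homotopic_with_trans[OF homotopic_if_subordinate homotopic_if_subordinate] \<phi> \<psi> empty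
    by blast
qed

section \<open>Covers of a contractible space without a rainbow point\<close>

text \<open>
  The cover map of the averaged family avoids the barycentre: a point sent there would make the
  matrix of the values of the \<open>\<phi> i\<close> doubly stochastic, and a permutation along which that matrix is
  positive is excluded by assumption. Composed with a retraction of the punctured affine hull onto
  the boundary of the simplex, the map is null-homotopic on the contractible space \<open>B\<close>; on \<open>L\<close> the
  retraction changes nothing.
\<close>

lemma null_homotopic_if_no_rainbow:
  fixes U :: "'n::finite \<Rightarrow> 'n \<Rightarrow> 'a::metric_space set"
  assumes B: "contractible B" "B \<noteq> {}"
    and U: "\<And>i. is_open_cover (top_of_set B) (U i)"
    and no: "\<And>\<pi>. \<pi> permutes (UNIV :: 'n set) \<Longrightarrow> (\<Inter>i. U i (\<pi> i)) = {}"
    and L: "L \<subseteq> B" "L \<inter> (\<Inter>j. \<Union>i. U i j) = {}"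
  shows "\<exists>\<psi> a. subordinate L (\<lambda>j. L \<inter> (\<Union>i. U i j)) \<psi> \<and> a \<in> simplex_bdry \<and>
    homotopic_with_canon (\<lambda>_. True) L simplex_bdry (cover_map \<psi>) (\<lambda>_. a)"
proof -
  obtain \<phi> where \<phi>: "\<And>i. subordinate B (U i) (\<phi> i)"
    using subordinate_exists[OF U] by metis
  let ?n = "real CARD('n)"
  define \<psi> where "\<psi> j x = (\<Sum>i\<in>UNIV. \<phi> i j x) / ?n" for j x
  have nz: "\<exists>i. \<phi> i j x \<noteq> 0" if "\<psi> j x \<noteq> 0" for j x
    using that by (auto simp: \<psi>_def intro: ccontr)
  have \<psi>B: "subordinate B (\<lambda>j. \<Union>i. U i j) \<psi>"
    unfolding subordinate_def
  proof (intro conjI allI ballI impI)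
    fix j show "continuous_on B (\<psi> j)"
      unfolding \<psi>_def using \<phi> by (intro continuous_intros) (auto simp: subordinate_def)
  next
    fix x j assume x: "x \<in> B"
    show "0 \<le> \<psi> j x" unfolding \<psi>_def
      using \<phi> x by (auto simp: subordinate_def intro!: divide_nonneg_nonneg sum_nonneg)
    have "(\<Sum>j\<in>UNIV. \<Sum>i\<in>UNIV. \<phi> i j x) = (\<Sum>i\<in>UNIV. \<Sum>j\<in>UNIV. \<phi> i j x)"
      by (rule sum.swap)
    also have "\<dots> = ?n" using \<phi> x by (simp add: subordinate_def)
    finally show "(\<Sum>j\<in>UNIV. \<psi> j x) = 1"
      by (simp add: \<psi>_def flip: sum_divide_distrib)
    show "x \<in> (\<Union>i. U i j)" if nonzero: "\<psi> j x \<noteq> 0"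
    proof -
      obtain i where "\<phi> i j x \<noteq> 0" using nz[OF nonzero] by blast
      then have "x \<in> U i j" using \<phi>[of i] x by (simp add: subordinate_def)
      then show ?thesis by blast
    qed
  qed
  define b :: "real^'n" where "b = (\<chi> i. 1 / ?n)"
  have b: "b \<in> rel_interior std_simplex"
    unfolding rel_interior_std_simplex by (simp add: std_simplex_def b_def)
  have avoid: "cover_map \<psi> x \<noteq> b" if x: "x \<in> B" for x
  proof
    assume eq: "cover_map \<psi> x = b"
    have cols: "(\<Sum>i\<in>UNIV. \<phi> i j x) = 1" for j
    proof -
      have "\<psi> j x = 1 / ?n" using arg_cong[OF eq, of "\<lambda>v. v $ j"] by (simp add: b_def)
      then show ?thesis by (simp add: \<psi>_def)
    qed
    obtain \<pi> where \<pi>: "\<pi> permutes UNIV" "\<forall>i. 0 < \<phi> i (\<pi> i) x"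
      using doubly_stochastic_positive_permutation[of "\<lambda>i j. \<phi> i j x"] \<phi> x cols
      by (auto simp: subordinate_def)
    have "x \<in> U i (\<pi> i)" for i
      using \<phi>[of i] x \<pi>(2)[rule_format, of i] by (simp add: subordinate_def)
    then have "x \<in> (\<Inter>i. U i (\<pi> i))" by blast
    with no[OF \<pi>(1)] show False by blast
  qed
  obtain r where r: "retraction (affine hull std_simplex - {b}) simplex_bdry r"
    using rel_frontier_retract_of_punctured_affine_hull
      [OF compact_imp_bounded compact_convex_std_simplex(2) b, OF compact_convex_std_simplex(1)]
    by (auto simp: retract_of_def simplex_bdry_def)
  have into: "cover_map \<psi> ` B \<subseteq> affine hull std_simplex - {b}"
    using avoid cover_map_in_std_simplex[OF \<psi>B] hull_subset[of std_simplex affine] by blast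
  have contr: "continuous_on B (r \<circ> cover_map \<psi>)"
    using r into \<psi>B
    by (intro continuous_on_compose continuous_on_cover_map)
       (auto simp: subordinate_def retraction_def intro: continuous_on_subset)
  have rinto: "(r \<circ> cover_map \<psi>) \<in> B \<rightarrow> simplex_bdry"
    using r into unfolding retraction_def by (fastforce simp: Pi_iff)
  obtain a where a: "homotopic_with_canon (\<lambda>_. True) B simplex_bdry (r \<circ> cover_map \<psi>) (\<lambda>_. a)"
    using nullhomotopic_from_contractible[OF contr rinto B(1)] by blast
  have "a \<in> simplex_bdry"
    using homotopic_with_imp_subset2[OF a] B(2) by auto
  moreover have \<psi>L: "subordinate L (\<lambda>j. L \<inter> (\<Union>i. U i j)) \<psi>"
    using \<psi>B L(1) by (auto simp: subordinate_def intro: continuous_on_subset)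
  moreover have "homotopic_with_canon (\<lambda>_. True) L simplex_bdry (cover_map \<psi>) (\<lambda>_. a)"
  proof (rule homotopic_with_eq[OF homotopic_with_subset_left[OF a L(1)]])
    fix x assume x: "x \<in> topspace (top_of_set L)"
    then obtain j where "x \<notin> (\<Union>i. U i j)" using L(2) unfolding topspace_euclidean_subtopology by blast
    then have "\<psi> j x = 0" using \<psi>L x unfolding subordinate_def by (metis Int_iff topspace_euclidean_subtopology)
    then have "cover_map \<psi> x \<in> simplex_bdry"
      using cover_map_in_std_simplex[OF \<psi>L] x by (auto simp: simplex_bdry_eq)
    then show "cover_map \<psi> x = (r \<circ> cover_map \<psi>) x"
      using r by (simp add: retraction_def)
  qed auto
  ultimately show ?thesis by blast
qed

section \<open>Neighbourhoods of closed covers\<close>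

text \<open>
  The sum of the distances to the \<open>C i\<close> is positive on \<open>K\<close> and attains a positive minimum. A point
  common to all \<open>e\<close>-neighbourhoods has sum at most \<open>CARD('i) * e\<close>, which is too small for small \<open>e\<close>.
\<close>

lemma eventually_neighbourhoods_disjoint:
  fixes C :: "'i::finite \<Rightarrow> 'a::metric_space set"
  assumes K: "compact K" and C: "\<And>i. closed (C i)" and empty: "K \<inter> (\<Inter>i. C i) = {}"
  shows "eventually (\<lambda>e. K \<inter> (\<Inter>i. \<Union>c\<in>C i. ball c e) = {}) (at_right 0)"
proof (cases "K = {} \<or> (\<exists>i. C i = {})")
  case True
  then have "K \<inter> (\<Inter>i. \<Union>c\<in>C i. ball c e) = {}" for e
    by (elim disjE exE) force+
  then show ?thesis by simp
next
  case False
  define s where "s x = (\<Sum>i\<in>UNIV. infdist x (C i))" for x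
  have "continuous_on K s" unfolding s_def by (intro continuous_intros)
  then obtain x0 where x0: "x0 \<in> K" "\<And>x. x \<in> K \<Longrightarrow> s x0 \<le> s x"
    using continuous_attains_inf[OF K] False by blast
  obtain i where "x0 \<notin> C i" using x0(1) empty by blast
  then have "0 < infdist x0 (C i)"
    using C False infdist_pos_not_in_closed by blast
  then have pos: "0 < s x0"
    unfolding s_def by (intro sum_pos2[of _ i]) (auto simp: infdist_nonneg)
  have "K \<inter> (\<Inter>i. \<Union>c\<in>C i. ball c e) = {}" if e: "0 < e" "e < s x0 / real CARD('i)" for e
  proof (rule ccontr)
    assume "K \<inter> (\<Inter>i. \<Union>c\<in>C i. ball c e) \<noteq> {}"
    then obtain x where "x \<in> K" and "x \<in> (\<Inter>i. \<Union>c\<in>C i. ball c e)" by blast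
    then have x: "x \<in> K" "\<exists>c\<in>C i. dist c x < e" for i by auto
    have "infdist x (C i) \<le> e" for i
      using x(2)[of i] infdist_le2 by (metis dist_commute less_imp_le)
    then have "s x \<le> real CARD('i) * e"
      unfolding s_def using sum_bounded_above[of UNIV "\<lambda>i. infdist x (C i)" e] by simp
    also have "\<dots> < s x0" using e by (simp add: field_simps)
    finally show False using x0(2)[OF x(1)] by simp
  qed
  then show ?thesis
    using pos by (subst eventually_at_right[of 0 "s x0 / real CARD('i) "]) (auto intro!: exI[of _ "s x0 / real CARD('i)"])
qed

section \<open>Null-homotopic covers and rainbow points\<close>

text \<open>
  Bridge between \<^const>\<open>mu\<close> and concrete data: a single open enlargement \<open>W\<close> and a single
  subordinate family with null-homotopic cover map show that the class is null. Whether \<open>C\<close> is open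
  or closed, \<^const>\<open>mu\<close> is computed from some open enlargement \<open>V\<close> of \<open>C\<close>; for open \<open>C\<close>, it is
  \<open>C\<close> itself.
\<close>

lemma null_class_mu:
  fixes C W :: "'n::finite \<Rightarrow> 'a::metric_space set" and h :: "real^'n \<Rightarrow> nat \<Rightarrow> real"
  assumes h: "homeomorphic_map (top_of_set simplex_bdry) (nsphere (CARD('n) - 2)) h"
    and C: "is_open_cover (top_of_set L) C \<or> is_closed_cover (top_of_set L) C"
    and W: "\<And>j. openin (top_of_set L) (W j)" "\<And>j. C j \<subseteq> W j" "L \<inter> (\<Inter>j. W j) = {}"
    and \<psi>: "subordinate L W \<psi>" and a: "a \<in> simplex_bdry"
    and null: "homotopic_with_canon (\<lambda>_. True) L simplex_bdry (cover_map \<psi>) (\<lambda>_. a)"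
  shows "null_class (top_of_set L) (nsphere (CARD('n) - 2)) (mu h (top_of_set L) C)"
proof -
  let ?T = "top_of_set L" and ?Y = "nsphere (CARD('n) - 2)"
  have cov: "L \<subseteq> (\<Union>j. C j)" "\<And>j. C j \<subseteq> L"
    using C by (auto simp: is_open_cover_def is_closed_cover_def)
  have WL: "W j \<subseteq> L" for j by (rule openin_imp_subset[OF W(1)])
  have Winter: "(\<Inter>j. W j) = {}"
    using W(3) WL by blast
  then have Cinter: "(\<Inter>j. C j) = {}"
    using W(2) by blast
  have "(\<Union>j. W j) = L"
  proof
    show "(\<Union>j. W j) \<subseteq> L" using WL by blast
    show "L \<subseteq> (\<Union>j. W j)" using cov(1) W(2) by blast
  qed
  then have Wcov: "is_open_cover ?T W \<and> (\<forall>j. C j \<subseteq> W j) \<and> (\<Inter>j. W j) = {}"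
    using W(1,2) Winter by (simp add: is_open_cover_def)
  obtain V where V: "is_open_cover ?T V" "\<And>j. C j \<subseteq> V j" "(\<Inter>j. V j) = {}"
    and mu: "mu h ?T C = mu_open h ?T V"
  proof (cases "is_open_cover ?T C")
    case True
    then show ?thesis using that[of C] Cinter by (simp add: mu_def)
  next
    case False
    let ?V = "SOME U. is_open_cover ?T U \<and> (\<forall>i. C i \<subseteq> U i) \<and> (\<Inter>i. U i) = {}"
    have "is_open_cover ?T ?V \<and> (\<forall>i. C i \<subseteq> ?V i) \<and> (\<Inter>i. ?V i) = {}"
      by (rule someI[where P = "\<lambda>U. is_open_cover ?T U \<and> (\<forall>i. C i \<subseteq> U i) \<and> (\<Inter>i. U i) = {}", OF Wcov])
    then show ?thesis using that[of ?V] False by (simp add: mu_def mu_closed_def)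
  qed
  define \<phi> where "\<phi> = (SOME \<phi>. partition_of_unity ?T V \<phi>)"
  have "partition_of_unity ?T V \<phi>"
    unfolding \<phi>_def using partition_of_unity_exists[OF V(1)] by (rule someI_ex)
  then have \<phi>: "subordinate L V \<phi>" by (rule partition_of_unity_imp_subordinate)
  have "homotopic_with_canon (\<lambda>_. True) L simplex_bdry (cover_map \<phi>) (cover_map \<psi>)"
    by (rule homotopic_if_common_core[OF \<phi> \<psi>, where C = C])
       (use V W cov in \<open>auto simp: is_open_cover_def\<close>)
  then have "homotopic_with_canon (\<lambda>_. True) L simplex_bdry (cover_map \<phi>) (\<lambda>_. a)"
    using null homotopic_with_trans by blast
  then have "homotopic_with (\<lambda>_. True) ?T ?Y (h \<circ> cover_map \<phi>) (h \<circ> (\<lambda>_. a))"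
    by (rule homotopic_with_compose_continuous_map_left)
       (use h homeomorphic_imp_continuous_map in auto)
  then have hom: "homotopic_with (\<lambda>_. True) ?T ?Y (h \<circ> cover_map \<phi>) (\<lambda>_. h a)"
    by (simp add: o_def)
  have "mu h ?T C = homotopy_class ?T ?Y (\<lambda>_. h a)"
    unfolding mu mu_open_def \<phi>_def[symmetric] homotopy_class_def
    using hom homotopic_with_trans homotopic_with_symD by blast
  moreover have "h a \<in> topspace ?Y"
    using homeomorphic_imp_surjective_map[OF h] a by auto
  ultimately show ?thesis unfolding null_class_def by blast
qed

theorem corollary3p1:
  fixes S :: "'n::finite \<Rightarrow> 'n \<Rightarrow> (real^'k) set"
    and h :: "real^'n \<Rightarrow> nat \<Rightarrow> real"
  assumes n: "CARD('n) \<ge> 2"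
    and h: "homeomorphic_map (top_of_set simplex_bdry) (nsphere (CARD('n) - 2)) h"
    and covers: "(\<forall>i. is_open_cover (top_of_set (cball 0 1)) (S i)) \<or>
                 (\<forall>i. is_closed_cover (top_of_set (cball 0 1)) (S i))"
    and F: "not_null_homotopic h (top_of_set (sphere 0 1)) (\<lambda>j. (\<Union>i. S i j) \<inter> sphere 0 1)"
  shows "\<exists>\<pi>. \<pi> permutes (UNIV :: 'n set) \<and> (\<Inter>i. S i (\<pi> i)) \<noteq> {}"
proof (rule ccontr)
  assume "\<nexists>\<pi>. \<pi> permutes (UNIV :: 'n set) \<and> (\<Inter>i. S i (\<pi> i)) \<noteq> {}"
  then have no: "(\<Inter>i. S i (\<pi> i)) = {}" if "\<pi> permutes (UNIV :: 'n set)" for \<pi>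
    using that by blast
  let ?B = "cball (0::real^'k) 1" and ?L = "sphere (0::real^'k) 1"
  have emptyF: "?L \<inter> (\<Inter>j. \<Union>i. S i j) = {}"
    using F by (auto simp: not_null_homotopic_def)
  \<comment> \<open>Open enlargements of all the covers that create neither a rainbow point nor, on the sphere,
    a point common to all the unions.\<close>
  obtain U where U: "\<And>i. is_open_cover (top_of_set ?B) (U i)" "\<And>i j. S i j \<subseteq> U i j"
    and noU: "\<And>\<pi>. \<pi> permutes (UNIV :: 'n set) \<Longrightarrow> (\<Inter>i. U i (\<pi> i)) = {}"
    and LU: "?L \<inter> (\<Inter>j. \<Union>i. U i j) = {}"
  proof (cases "\<forall>i. is_open_cover (top_of_set ?B) (S i)")
    case True
    then show ?thesis using that[of S] no emptyF by auto
  next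
    case False
    then have clo: "\<And>i. is_closed_cover (top_of_set ?B) (S i)" using covers by blast
    then have closedS: "closed (S i j)" for i j
      unfolding is_closed_cover_def using closedin_closed_trans closed_cball by blast
    have SB: "(\<Union>j. S i j) = ?B" for i using clo by (simp add: is_closed_cover_def)
    \<comment> \<open>Neighbourhoods commute with unions, so one disjointness lemma also serves the cover \<open>F\<close>.\<close>
    let ?avoid = "\<lambda>e. \<forall>\<pi>\<in>{\<pi>. \<pi> permutes (UNIV :: 'n set)}.
        ?B \<inter> (\<Inter>i. \<Union>c\<in>S i (\<pi> i). ball c e) = {}"
    let ?avoid_bdry = "\<lambda>e. ?L \<inter> (\<Inter>j. \<Union>c\<in>(\<Union>i. S i j). ball c e) = {}"
    have "\<forall>\<^sub>F e in at_right 0. ?avoid e"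
      by (intro eventually_ball_finite ballI eventually_neighbourhoods_disjoint)
         (use closedS no in auto)
    moreover have "\<forall>\<^sub>F e in at_right 0. ?avoid_bdry e"
      by (intro eventually_neighbourhoods_disjoint closed_UN)
         (use closedS emptyF in auto)
    ultimately have "\<forall>\<^sub>F e in at_right 0. ?avoid e \<and> ?avoid_bdry e \<and> 0 < e"
      using eventually_at_right_less[of "0::real"] by (simp only: eventually_conj_iff)
    then have "\<exists>e. ?avoid e \<and> ?avoid_bdry e \<and> 0 < e"
      by (rule eventually_happens'[OF trivial_limit_at_right_real])
    then obtain e where e: "0 < e" and e1: "?avoid e" and e2: "?avoid_bdry e"
      by (elim exE conjE)
    define U where "U i j = ?B \<inter> (\<Union>c\<in>S i j. ball c e)" for i j
    have SU: "S i j \<subseteq> U i j" for i j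
    proof
      fix x assume x: "x \<in> S i j"
      then have "x \<in> (\<Union>c\<in>S i j. ball c e)" using e by (auto intro: bexI[of _ x])
      then show "x \<in> U i j" using x SB[of i] unfolding U_def by blast
    qed
    show ?thesis
    proof (rule that[of U])
      fix i
      have "openin (top_of_set ?B) (U i j)" for j
        unfolding U_def by (intro openin_open_Int open_UN ballI open_ball)
      moreover have "(\<Union>j. U i j) = ?B"
      proof
        show "(\<Union>j. U i j) \<subseteq> ?B" unfolding U_def by blast
        show "?B \<subseteq> (\<Union>j. U i j)" using SU unfolding SB[of i, symmetric] by blast
      qed
      ultimately show "is_open_cover (top_of_set ?B) (U i)" by (simp add: is_open_cover_def)
      show "S i j \<subseteq> U i j" for j by (rule SU)
    next
      fix \<pi> assume "\<pi> permutes (UNIV :: 'n set)"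
      then have "?B \<inter> (\<Inter>i. \<Union>c\<in>S i (\<pi> i). ball c e) = {}" using e1 by simp
      then show "(\<Inter>i. U i (\<pi> i)) = {}" unfolding U_def by blast
    next
      have "(\<Union>i. U i j) \<subseteq> (\<Union>c\<in>(\<Union>i. S i j). ball c e)" for j
        unfolding U_def by blast
      then have "?L \<inter> (\<Inter>j. \<Union>i. U i j) \<subseteq> ?L \<inter> (\<Inter>j. \<Union>c\<in>(\<Union>i. S i j). ball c e)"
        by (intro Int_mono[OF order_refl] INF_mono')
      then show "?L \<inter> (\<Inter>j. \<Union>i. U i j) = {}" by (simp only: e2 subset_empty)
    qed
  qed
  let ?W = "\<lambda>j. ?L \<inter> (\<Union>i. U i j)"
  have LB: "?L \<subseteq> ?B" by auto
  obtain \<psi> a where \<psi>: "subordinate ?L ?W \<psi>" and a: "a \<in> simplex_bdry"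
    and null: "homotopic_with_canon (\<lambda>_. True) ?L simplex_bdry (cover_map \<psi>) (\<lambda>_. a)"
    using null_homotopic_if_no_rainbow[OF convex_imp_contractible[OF convex_cball] _ U(1) noU LB LU]
    by auto
  have Wopen: "openin (top_of_set ?L) (?W j)" for j
  proof -
    have "openin (top_of_set ?B) (\<Union>i. U i j)"
      using U(1) by (auto simp: is_open_cover_def)
    then obtain O' where "open O'" "(\<Union>i. U i j) = ?B \<inter> O'" by (auto simp: openin_open)
    then show ?thesis using LB by (metis inf.absorb1 inf_assoc openin_open_Int)
  qed
  have "null_class (top_of_set ?L) (nsphere (CARD('n) - 2))
      (mu h (top_of_set ?L) (\<lambda>j. (\<Union>i. S i j) \<inter> ?L))"
  proof (rule null_class_mu[OF h _ Wopen _ _ \<psi> a null])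
    show "is_open_cover (top_of_set ?L) (\<lambda>j. (\<Union>i. S i j) \<inter> ?L) \<or>
        is_closed_cover (top_of_set ?L) (\<lambda>j. (\<Union>i. S i j) \<inter> ?L)"
      using F by (simp add: not_null_homotopic_def)
    show "(\<Union>i. S i j) \<inter> ?L \<subseteq> ?W j" for j using U(2) by blast
    show "?L \<inter> (\<Inter>j. ?W j) = {}" using LU by blast
  qed
  with F show False by (simp add: not_null_homotopic_def)
qed

end
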